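(* $\operatorname{olws}_R(3)=5$, where $\operatorname{olws}_R(w)$ denotes the on-line width of the class of semi-orders of width at most $w$ presented with (unit-interval) representation.
   Context: Semi-orders with representation. A finite sequence of closed unit-length intervals $[r_1-1,r_1],\ldots,[r_n-1,r_n]$ on the real line (repetitions of the same interval are allowed, and different indices are different elements) represents the poset on elements $x_1,\ldots,x_n$ in which $x_i<x_j$ if and only if $r_i<r_j-1$; thus two distinct elements are incomparable exactly when their intervals intersect. Posets arising in this way are called semi-orders. The width of a poset is the maximum size of an antichain. On-line chain partitioning game. Fix a positive integer $w$. In round $i$ the presenter introduces an element $x_i$ by giving a closed unit interval $[r_i-1,r_i]$ (i.e. the real number $r_i$), such that the semi-order represented by all intervals presented so far has width at most $w$. The (deterministic) on-line algorithm must then immediately and irrevocably assign $x_i$ to a chain, i.e. give it a chain label such that all elements with the same label are pairwise comparable (their intervals are pairwise disjoint). The assignment may depend only on the intervals presented so far and on the chains to which the earlier elements were assigned. The presenter may choose each interval depending on the algorithm's previous assignments. The number of chains used is the number of distinct labels used. On-line width. $\operatorname{olws}_R(w)$ is the largest integer $k$ for which there exists a strategy of the presenter that forces any on-line algorithm to use (at least) $k$ chains on a semi-order of width at most $w$ presented in this way as unit intervals. *)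

theory Defs
  imports Complex_Main
begin

text \<open>
  A finite sequence of closed unit intervals is given by the list \<open>rs\<close> of its right end points:
  position \<open>i\<close> stands for the interval \<open>{rs ! i - 1..rs ! i}\<close>. The elements of the represented
  semi-order are the positions, so that a repeated interval yields distinct elements.
\<close>

definition semiorder_rel :: "real list \<Rightarrow> nat rel" where
  "semiorder_rel rs = {(i, j). i < length rs \<and> j < length rs \<and> rs ! i < rs ! j - 1}"

definition antichain_on :: "'a set \<Rightarrow> 'a rel \<Rightarrow> 'a set \<Rightarrow> bool" where
  "antichain_on X R A \<longleftrightarrow> A \<subseteq> X \<and> (\<forall>x\<in>A. \<forall>y\<in>A. (x, y) \<notin> R)"

definition poset_width :: "'a set \<Rightarrow> 'a rel \<Rightarrow> nat" where
  "poset_width X R = Max (card ` {A. antichain_on X R A})"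

definition interval_width :: "real list \<Rightarrow> nat" where
  "interval_width rs = poset_width {..<length rs} (semiorder_rel rs)"

definition chain_partition :: "real list \<Rightarrow> nat list \<Rightarrow> bool" where
  "chain_partition rs cs \<longleftrightarrow> length cs = length rs \<and>
     (\<forall>i<length rs. \<forall>j<length rs. i \<noteq> j \<longrightarrow> cs ! i = cs ! j \<longrightarrow>
        (i, j) \<in> semiorder_rel rs \<or> (j, i) \<in> semiorder_rel rs)"

text \<open>
  The arguments of an algorithm are all intervals presented so far, the current one being the last,
  and the chain labels of the earlier elements; its value is the label of the current element.
\<close>

type_synonym algorithm = "real list \<Rightarrow> nat list \<Rightarrow> nat"

text \<open>
  The arguments of a presenter's strategy are the intervals presented so far and their labels;
  its value is the next interval, or \<open>None\<close> if the presentation ends.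
\<close>

type_synonym presenter = "real list \<Rightarrow> nat list \<Rightarrow> real option"

primrec labels :: "algorithm \<Rightarrow> real list \<Rightarrow> nat \<Rightarrow> nat list" where
  "labels A rs 0 = []"
| "labels A rs (Suc n) = labels A rs n @ [A (take (Suc n) rs) (labels A rs n)]"

text \<open>
  Width does not increase when passing to a prefix, so \<open>interval_width rs \<le> w\<close> says that \<open>rs\<close>
  respects the width bound in every round.
\<close>

definition online_algorithm :: "nat \<Rightarrow> algorithm \<Rightarrow> bool" where
  "online_algorithm w A \<longleftrightarrow>
     (\<forall>rs. interval_width rs \<le> w \<longrightarrow> chain_partition rs (labels A rs (length rs)))"

primrec play :: "presenter \<Rightarrow> algorithm \<Rightarrow> nat \<Rightarrow> real list \<times> nat list" where
  "play S A 0 = ([], [])"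
| "play S A (Suc n) =
     (case play S A n of (rs, cs) \<Rightarrow>
        (case S rs cs of
           None \<Rightarrow> (rs, cs)
         | Some r \<Rightarrow> (rs @ [r], cs @ [A (rs @ [r]) cs])))"

text \<open>
  The single strategy \<open>S\<close> has to work against all algorithms. Every round has to respect the width
  bound, and the presentation has to end after finitely many rounds.
\<close>

definition forces_chains :: "nat \<Rightarrow> nat \<Rightarrow> bool" where
  "forces_chains w k \<longleftrightarrow>
     (\<exists>S. \<forall>A. online_algorithm w A \<longrightarrow>
        (\<forall>n. interval_width (fst (play S A n)) \<le> w) \<and>
        (\<exists>n rs cs. play S A n = (rs, cs) \<and> S rs cs = None \<and> k \<le> card (set cs)))"

definition olws_R :: "nat \<Rightarrow> nat" where
  "olws_R w = (GREATEST k. forces_chains w k)"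

end

theory Submission
  imports Defs
begin

text \<open>
  Upper bound: every interval that meets a given unit interval contains one of its end points, so
  First Fit sees at most \<open>2 * (w - 1)\<close> forbidden labels. Lower bound: the game against four labels
  is won by the presenter within seven rounds, even if all end points are multiples of \<open>1 / 9\<close>.
  The strategy tree was found by an exhaustive search; up to renaming of labels it has only thirty
  nodes.
\<close>

section \<open>Width and chain partitions\<close>

lemma antichain_on_semiorder_rel_iff:
  "antichain_on {..<length rs} (semiorder_rel rs) A \<longleftrightarrow>
     A \<subseteq> {..<length rs} \<and> (\<forall>i\<in>A. \<forall>j\<in>A. rs ! j \<le> rs ! i + 1)"
proof -
  have "rs ! i < rs ! j - 1 \<longleftrightarrow> \<not> rs ! j \<le> rs ! i + 1" for i j
    by linarith
  then show ?thesis
    unfolding antichain_on_def semiorder_rel_def by blast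
qed

lemma interval_width_le_iff:
  "interval_width rs \<le> w \<longleftrightarrow>
     (\<forall>A. antichain_on {..<length rs} (semiorder_rel rs) A \<longrightarrow> card A \<le> w)"
proof -
  let ?F = "{A. antichain_on {..<length rs} (semiorder_rel rs) A}"
  have "?F \<subseteq> Pow {..<length rs}"
    by (auto simp: antichain_on_def)
  then have "finite ?F"
    by (rule finite_subset) simp
  moreover have "{} \<in> ?F"
    by (simp add: antichain_on_def)
  ultimately show ?thesis
    unfolding interval_width_def poset_width_def by (subst Max_le_iff) auto
qed

lemma interval_width_Nil: "interval_width [] = 0"
  using interval_width_le_iff[of "[]" 0] by (auto simp: antichain_on_def)

text \<open>An antichain lies in the window of length 1 that starts at its leftmost end point. It
  therefore suffices to count end points in finitely many windows, which makes the width bound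
  checkable by computation.\<close>

lemma interval_width_leI:
  assumes "\<And>r. r \<in> set rs \<Longrightarrow> length (filter (\<lambda>s. r \<le> s \<and> s \<le> r + 1) rs) \<le> w"
  shows "interval_width rs \<le> w"
  unfolding interval_width_le_iff
proof (intro allI impI)
  fix A assume "antichain_on {..<length rs} (semiorder_rel rs) A"
  then have A: "A \<subseteq> {..<length rs}" "\<And>i j. i \<in> A \<Longrightarrow> j \<in> A \<Longrightarrow> rs ! j \<le> rs ! i + 1"
    by (auto simp: antichain_on_semiorder_rel_iff)
  show "card A \<le> w"
  proof (cases "A = {}")
    case False
    have fin: "finite A"
      using A(1) finite_subset by blast
    define i where "i = arg_min_on (\<lambda>i. rs ! i) A"
    have i: "i \<in> A" "\<And>j. j \<in> A \<Longrightarrow> rs ! i \<le> rs ! j"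
      using arg_min_if_finite[OF fin False, of "\<lambda>i. rs ! i"] unfolding i_def
      by (auto simp: not_less)
    have "A \<subseteq> {j. j < length rs \<and> rs ! i \<le> rs ! j \<and> rs ! j \<le> rs ! i + 1}"
      using A i by auto
    then have "card A \<le> length (filter (\<lambda>s. rs ! i \<le> s \<and> s \<le> rs ! i + 1) rs)"
      unfolding length_filter_conv_card by (intro card_mono) auto
    also have "\<dots> \<le> w"
      using A(1) i(1) by (intro assms) auto
    finally show ?thesis .
  qed simp
qed

lemma chain_partition_iff:
  "chain_partition rs cs \<longleftrightarrow> length cs = length rs \<and>
     (\<forall>i<length rs. \<forall>j<length rs. i \<noteq> j \<longrightarrow> cs ! i = cs ! j \<longrightarrow> 1 < \<bar>rs ! i - rs ! j\<bar>)"
proof -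
  have "1 < \<bar>rs ! i - rs ! j\<bar> \<longleftrightarrow> rs ! i < rs ! j - 1 \<or> rs ! j < rs ! i - 1" for i j
    by linarith
  then show ?thesis
    unfolding chain_partition_def semiorder_rel_def by auto
qed

lemma chain_partition_snoc_iff:
  assumes "length cs = length rs"
  shows "chain_partition (rs @ [r]) (cs @ [c]) \<longleftrightarrow> chain_partition rs cs \<and>
     (\<forall>i<length rs. cs ! i = c \<longrightarrow> 1 < \<bar>rs ! i - r\<bar>)"
  unfolding chain_partition_iff using assms
  by (auto simp: nth_append less_Suc_eq abs_minus_commute)

lemma chain_partition_map:
  assumes "inj_on f (set cs)"
  shows "chain_partition rs (map f cs) \<longleftrightarrow> chain_partition rs cs"
proof -
  have "map f cs ! i = map f cs ! j \<longleftrightarrow> cs ! i = cs ! j" if "i < length cs" "j < length cs" for i j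
    using assms that by (simp add: inj_on_eq_iff)
  then show ?thesis
    unfolding chain_partition_def by (metis length_map)
qed

lemma labels_append: "n \<le> length rs \<Longrightarrow> labels A (rs @ xs) n = labels A rs n"
  by (induction n) auto

text \<open>Links the two recursions: the guarantee in \<open>online_algorithm\<close> speaks of
  \<open>labels\<close>, while the game is run by \<open>play\<close>.\<close>

lemma play_eq_labels:
  "play S A n = (rs, cs) \<Longrightarrow> cs = labels A rs (length rs)"
  by (induction n arbitrary: rs cs)
    (auto split: prod.splits option.splits simp: labels_append)

section \<open>First Fit\<close>

text \<open>The current interval is \<open>last rs\<close> and has no label yet, hence the index
  bound \<open>length cs\<close>.\<close>

definition first_fit :: algorithm where
  "first_fit rs cs = (LEAST c. \<forall>i<length cs. cs ! i = c \<longrightarrow> 1 < \<bar>rs ! i - last rs\<bar>)"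

lemma first_fit_label:
  assumes "length cs = length rs" "i < length rs" "cs ! i = first_fit (rs @ [r]) cs"
  shows "1 < \<bar>rs ! i - r\<bar>"
proof -
  let ?P = "\<lambda>c. \<forall>i<length cs. cs ! i = c \<longrightarrow> 1 < \<bar>(rs @ [r]) ! i - last (rs @ [r])\<bar>"
  obtain c where "c \<notin> set cs"
    using ex_new_if_finite[of "set cs"] by auto
  then have "?P c"
    by (auto simp: in_set_conv_nth)
  then have "?P (first_fit (rs @ [r]) cs)"
    unfolding first_fit_def by (rule LeastI)
  then show ?thesis
    using assms by (auto simp: nth_append)
qed

lemma labels_first_fit:
  "n \<le> length rs \<Longrightarrow> chain_partition (take n rs) (labels first_fit rs n)"
proof (induction n)
  case 0
  then show ?case by (simp add: chain_partition_iff)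
next
  case (Suc n)
  then have IH: "chain_partition (take n rs) (labels first_fit rs n)" by simp
  moreover have "length (labels first_fit rs n) = length (take n rs)"
    using IH by (simp add: chain_partition_iff)
  ultimately show ?case
    using Suc.prems first_fit_label[of _ "take n rs" _ "rs ! n"]
    by (simp add: take_Suc_conv_app_nth chain_partition_snoc_iff)
qed

lemma online_algorithm_first_fit: "online_algorithm w first_fit"
  unfolding online_algorithm_def using labels_first_fit[OF order_refl] by simp

text \<open>The end points on one side lie in a window of length 1 bounded by \<open>r\<close>.
  Those elements thus form an antichain together with the new one, which has index
  \<open>length rs\<close>.\<close>

lemma card_one_sided_neighbours:
  assumes "interval_width (rs @ [r]) \<le> w"
  shows "card {i. i < length rs \<and> rs ! i \<le> r \<and> r \<le> rs ! i + 1} < w"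
    and "card {i. i < length rs \<and> r \<le> rs ! i \<and> rs ! i \<le> r + 1} < w"
proof -
  have *: "card N < w" if N: "N \<subseteq> {..<length rs}"
    "\<And>i j. i \<in> N \<Longrightarrow> j \<in> N \<Longrightarrow> rs ! j \<le> rs ! i + 1"
    "\<And>i. i \<in> N \<Longrightarrow> rs ! i \<le> r + 1 \<and> r \<le> rs ! i + 1" for N
  proof -
    have "antichain_on {..<length (rs @ [r])} (semiorder_rel (rs @ [r])) (insert (length rs) N)"
      unfolding antichain_on_semiorder_rel_iff using N
      by (auto simp: nth_append subset_iff less_Suc_eq)
    then have "card (insert (length rs) N) \<le> w"
      using assms unfolding interval_width_le_iff by blast
    moreover have "length rs \<notin> N" "finite N"
      using N(1) finite_subset by auto
    ultimately show ?thesis by simp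
  qed
  show "card {i. i < length rs \<and> rs ! i \<le> r \<and> r \<le> rs ! i + 1} < w"
    by (rule *) auto
  show "card {i. i < length rs \<and> r \<le> rs ! i \<and> rs ! i \<le> r + 1} < w"
    by (rule *) auto
qed

lemma first_fit_less:
  assumes "length cs = length rs" "interval_width (rs @ [r]) \<le> w"
  shows "first_fit (rs @ [r]) cs < 2 * w - 1"
proof -
  let ?L = "{i. i < length rs \<and> rs ! i \<le> r \<and> r \<le> rs ! i + 1}"
  let ?U = "{i. i < length rs \<and> r \<le> rs ! i \<and> rs ! i \<le> r + 1}"
  let ?B = "(\<lambda>i. cs ! i) ` (?L \<union> ?U)"
  have fin: "finite ?B" by simp
  have "card ?B \<le> card (?L \<union> ?U)"
    by (rule card_image_le) simp
  also have "\<dots> \<le> card ?L + card ?U"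
    by (rule card_Un_le)
  \<comment> \<open>Both summands are strictly below \<open>w\<close>, so \<open>w\<close> is
    positive and the subtraction on naturals is not truncated.\<close>
  also have "\<dots> < 2 * w - 1"
    using card_one_sided_neighbours[OF assms(2)] by linarith
  finally have "card ?B < card {..<2 * w - 1}" by simp
  then have "\<not> {..<2 * w - 1} \<subseteq> ?B"
    using card_mono[OF fin] by (meson not_le)
  then obtain c where c: "c < 2 * w - 1" "c \<notin> ?B"
    by blast
  have "1 < \<bar>rs ! i - r\<bar>" if "i < length rs" "cs ! i = c" for i
  proof (rule ccontr)
    assume "\<not> 1 < \<bar>rs ! i - r\<bar>"
    then have "i \<in> ?L \<union> ?U" using that by auto
    then show False using c(2) that by blast
  qed
  then have "first_fit (rs @ [r]) cs \<le> c"
    unfolding first_fit_def using assms(1) by (intro Least_le) (auto simp: nth_append)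
  with c show ?thesis by simp
qed

lemma play_first_fit:
  assumes "\<And>n. interval_width (fst (play S first_fit n)) \<le> w"
  shows "length (snd (play S first_fit n)) = length (fst (play S first_fit n)) \<and>
    set (snd (play S first_fit n)) \<subseteq> {..<2 * w - 1}"
proof (induction n)
  case (Suc n)
  obtain rs cs where p: "play S first_fit n = (rs, cs)" by fastforce
  show ?case
  proof (cases "S rs cs")
    case None
    then show ?thesis using Suc p by simp
  next
    case (Some r)
    then have "first_fit (rs @ [r]) cs < 2 * w - 1"
      using assms[of "Suc n"] Suc p by (intro first_fit_less) auto
    then show ?thesis using Suc p Some by simp
  qed
qed simp

lemma forces_chains_le:
  assumes "forces_chains w k"
  shows "k \<le> 2 * w - 1"
proof -
  from assms obtain S where S:
    "\<And>A. online_algorithm w A \<Longrightarrow> (\<forall>n. interval_width (fst (play S A n)) \<le> w) \<and>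
        (\<exists>n rs cs. play S A n = (rs, cs) \<and> S rs cs = None \<and> k \<le> card (set cs))"
    unfolding forces_chains_def by blast
  from S[OF online_algorithm_first_fit] obtain n where
    width: "\<And>n. interval_width (fst (play S first_fit n)) \<le> w"
    and k: "k \<le> card (set (snd (play S first_fit n)))"
    by (metis snd_conv)
  have "card (set (snd (play S first_fit n))) \<le> card {..<2 * w - 1}"
    using play_first_fit[OF width] by (intro card_mono) auto
  with k show ?thesis by simp
qed

section \<open>Positions won by the presenter\<close>

text \<open>Backward induction on the game tree with a given number of rounds left. The quantifier
  over algorithms becomes a local one over the legal labels of the next element.\<close>

primrec winning :: "nat \<Rightarrow> nat \<Rightarrow> nat \<Rightarrow> real list \<Rightarrow> nat list \<Rightarrow> bool" where
  "winning w k 0 rs cs \<longleftrightarrow> k \<le> card (set cs)"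
| "winning w k (Suc n) rs cs \<longleftrightarrow> k \<le> card (set cs) \<or>
     (\<exists>r. interval_width (rs @ [r]) \<le> w \<and>
       (\<forall>c. chain_partition (rs @ [r]) (cs @ [c]) \<longrightarrow> winning w k n (rs @ [r]) (cs @ [c])))"

text \<open>The strategy always picks a move that preserves \<open>winning\<close> and stops once
  \<open>k\<close> labels are in use. The number of rounds left is read off
  \<open>length rs\<close>, so the move depends on the position alone.\<close>

lemma forces_chainsI:
  assumes "winning w k N [] []"
  shows "forces_chains w k"
proof -
  define good where "good rs cs r \<longleftrightarrow> interval_width (rs @ [r]) \<le> w \<and>
    (\<forall>c. chain_partition (rs @ [r]) (cs @ [c]) \<longrightarrow>
      winning w k (N - Suc (length rs)) (rs @ [r]) (cs @ [c]))" for rs cs r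
  define S :: presenter where
    "S rs cs = (if k \<le> card (set cs) then None else Some (SOME r. good rs cs r))" for rs cs
  have "(\<forall>n. interval_width (fst (play S A n)) \<le> w) \<and>
        (\<exists>n rs cs. play S A n = (rs, cs) \<and> S rs cs = None \<and> k \<le> card (set cs))"
    if A: "online_algorithm w A" for A
  proof -
    have inv: "interval_width (fst (play S A n)) \<le> w \<and>
       winning w k (N - length (fst (play S A n))) (fst (play S A n)) (snd (play S A n)) \<and>
       (length (fst (play S A n)) = n \<or> k \<le> card (set (snd (play S A n))))" for n
    proof (induction n)
      case 0
      then show ?case using assms by (simp add: interval_width_Nil)
    next
      case (Suc n)
      obtain rs cs where p: "play S A n = (rs, cs)" by fastforce
      show ?case
      proof (cases "k \<le> card (set cs)")
        case True
        then have "play S A (Suc n) = (rs, cs)" by (simp add: p S_def)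
        then show ?thesis using Suc True p by simp
      next
        case False
        define r where "r = (SOME r. good rs cs r)"
        have win: "winning w k (N - length rs) rs cs" and len: "length rs = n"
          using Suc p False by auto
        \<comment> \<open>With no round left, \<open>winning\<close> would already give
          \<open>k\<close> labels.\<close>
        then have "N - length rs = Suc (N - Suc (length rs))"
          using False by (cases "N - length rs") auto
        then have "\<exists>r. good rs cs r"
          using win False by (auto simp: good_def)
        then have good: "good rs cs r"
          unfolding r_def by (rule someI_ex)
        have step: "play S A (Suc n) = (rs @ [r], cs @ [A (rs @ [r]) cs])"
          using False by (simp add: p S_def r_def)
        have "chain_partition (rs @ [r]) (cs @ [A (rs @ [r]) cs])"
          using A good play_eq_labels[OF step] unfolding good_def online_algorithm_def by metis
        then show ?thesis
          using good len step by (simp add: good_def)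
      qed
    qed
    \<comment> \<open>If the play has not stopped earlier, all \<open>N\<close> rounds are used up
      and \<open>winning\<close> is the goal itself.\<close>
    have "k \<le> card (set (snd (play S A N)))"
      using inv[of N] by auto
    then show ?thesis
      using inv by (metis S_def prod.collapse)
  qed
  then show ?thesis
    unfolding forces_chains_def by blast
qed

text \<open>Only equality of labels matters, so the presenter can keep his moves and read each
  answer through the renaming.\<close>

lemma winning_map:
  assumes "winning w k n rs cs" "inj_on f (set cs)"
  shows "winning w k n rs (map f cs)"
  using assms
proof (induction n arbitrary: rs cs f)
  case 0
  then show ?case by (simp add: card_image)
next
  case (Suc n)
  show ?case
  proof (cases "k \<le> card (set cs)")
    case True
    then show ?thesis using Suc.prems(2) by (simp add: card_image)
  next
    case False
    then obtain r where r: "interval_width (rs @ [r]) \<le> w"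
      "\<And>c. chain_partition (rs @ [r]) (cs @ [c]) \<Longrightarrow> winning w k n (rs @ [r]) (cs @ [c])"
      using Suc.prems(1) by auto
    have "winning w k n (rs @ [r]) (map f cs @ [d])"
      if d: "chain_partition (rs @ [r]) (map f cs @ [d])" for d
    proof -
      \<comment> \<open>The answer \<open>d\<close> is pulled back to a label \<open>c\<close>: a
        used one if \<open>d\<close> is in the image of \<open>f\<close>, otherwise a fresh one,
        with \<open>f\<close> extended by sending \<open>c\<close> to \<open>d\<close>.\<close>
      obtain c g where g: "inj_on g (set (cs @ [c]))" "map f cs @ [d] = map g (cs @ [c])"
      proof (cases "d \<in> f ` set cs")
        case True
        then obtain c where "c \<in> set cs" "d = f c" by auto
        then show ?thesis using Suc.prems(2) by (intro that[of f c]) (auto simp: insert_absorb)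
      next
        case False
        obtain c where c: "c \<notin> set cs"
          using ex_new_if_finite[of "set cs"] by auto
        then have "map (f(c := d)) cs = map f cs" by auto
        moreover have "inj_on (f(c := d)) (set (cs @ [c]))"
          using Suc.prems(2) c False by (auto simp: inj_on_def)
        ultimately show ?thesis by (intro that[of "f(c := d)" c]) auto
      qed
      then have "winning w k n (rs @ [r]) (cs @ [c])"
        using d r(2) chain_partition_map by metis
      then show ?thesis
        using Suc.IH g by metis
    qed
    then show ?thesis using r(1) by auto
  qed
qed

section \<open>Strategy trees\<close>

text \<open>
  The subtrees of \<open>Move p ts\<close> answer the admissible labels in increasing order; the new label
  is always the least unused one, and no subtree is needed for a label that completes the goal.
\<close>

datatype strategy = Move int "strategy list"

definition admissible :: "int \<Rightarrow> int list \<Rightarrow> nat list \<Rightarrow> int \<Rightarrow> nat \<Rightarrow> bool" where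
  "admissible u ps cs p c \<longleftrightarrow> list_all (\<lambda>(q, d). d = c \<longrightarrow> u < \<bar>q - p\<bar>) (zip ps cs)"

text \<open>The criterion of \<open>interval_width_leI\<close> in integers, where the unit length is
  \<open>u\<close>.\<close>

definition width_ok :: "int \<Rightarrow> nat \<Rightarrow> int list \<Rightarrow> bool" where
  "width_ok u w ps \<longleftrightarrow>
     list_all (\<lambda>p. length (filter (\<lambda>q. p \<le> q \<and> q \<le> p + u) ps) \<le> w) ps"

text \<open>The integer \<open>p\<close> stands for the right end point \<open>p / u\<close>, and the labels in use are \<open>{..<m}\<close>.\<close>

fun verify :: "int \<Rightarrow> nat \<Rightarrow> nat \<Rightarrow> nat \<Rightarrow> strategy \<Rightarrow> int list \<Rightarrow> nat list \<Rightarrow> nat \<Rightarrow> bool" where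
  "verify u w k 0 t ps cs m \<longleftrightarrow> False"
| "verify u w k (Suc n) (Move p ts) ps cs m \<longleftrightarrow> width_ok u w (ps @ [p]) \<and>
     list_all2 (\<lambda>t c. verify u w k n t (ps @ [p]) (cs @ [c]) (max m (Suc c)))
       ts (filter (admissible u ps cs p) [0..<min (Suc m) (k - 1)])"

definition scale :: "int \<Rightarrow> int list \<Rightarrow> real list" where
  "scale u ps = map (\<lambda>p. of_int p / of_int u) ps"

lemma interval_width_scale:
  assumes "0 < u" "width_ok u w ps"
  shows "interval_width (scale u ps) \<le> w"
proof (rule interval_width_leI)
  have *: "real_of_int q / real_of_int u \<le> real_of_int p / real_of_int u + 1 \<longleftrightarrow> q \<le> p + u" for p q
    using assms(1) by (simp add: field_simps flip: of_int_add)
  fix r assume "r \<in> set (scale u ps)"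
  then obtain p where p: "p \<in> set ps" "r = of_int p / of_int u"
    by (auto simp: scale_def)
  then show "length (filter (\<lambda>s. r \<le> s \<and> s \<le> r + 1) (scale u ps)) \<le> w"
    using assms by (auto simp: width_ok_def list_all_iff scale_def filter_map o_def *
        divide_le_cancel)
qed

lemma admissibleI:
  assumes "0 < u" "length cs = length ps" "chain_partition (scale u (ps @ [p])) (cs @ [c])"
  shows "admissible u ps cs p c"
proof -
  have *: "1 < \<bar>real_of_int q / real_of_int u - real_of_int p / real_of_int u\<bar> \<longleftrightarrow> u < \<bar>q - p\<bar>" for q
  proof -
    have "\<bar>real_of_int q / real_of_int u - real_of_int p / real_of_int u\<bar> =
        real_of_int \<bar>q - p\<bar> / real_of_int u"
      using assms(1) by (simp add: abs_divide flip: diff_divide_distrib)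
    then show ?thesis using assms(1) by (simp add: less_divide_eq del: of_int_abs)
  qed
  have "\<forall>i<length ps. cs ! i = c \<longrightarrow> u < \<bar>ps ! i - p\<bar>"
    using assms(2,3) by (auto simp: scale_def chain_partition_snoc_iff *)
  then show ?thesis
    using assms(2) by (auto simp: admissible_def list_all_iff set_zip)
qed

lemma list_all2_memberE:
  assumes "list_all2 P xs ys" "y \<in> set ys"
  obtains x where "x \<in> set xs" "P x y"
  using assms by (induction rule: list_all2_induct) auto

text \<open>The algorithm may answer with any natural number, but the tree covers only labels up to
  \<open>m\<close>. A larger label is as good as \<open>m\<close> by renaming, and a label from
  \<open>k - 1\<close> up to \<open>m\<close> completes the goal at once.\<close>

lemma winning_if_verify:
  assumes "0 < u" "verify u w k n t ps cs m" "length cs = length ps" "set cs = {..<m}"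
  shows "winning w k n (scale u ps) cs"
  using assms(2-)
proof (induction n arbitrary: t ps cs m)
  case (Suc n)
  obtain p ts where t: "t = Move p ts" by (cases t)
  have snoc: "scale u ps @ [of_int p / of_int u] = scale u (ps @ [p])"
    by (simp add: scale_def)
  have low: "winning w k n (scale u (ps @ [p])) (cs @ [c])"
    if c: "c \<le> m" "chain_partition (scale u (ps @ [p])) (cs @ [c])" for c
  proof (cases "c < k - 1")
    case True
    have "admissible u ps cs p c"
      using admissibleI assms(1) Suc.prems(2) c(2) by blast
    then have "c \<in> set (filter (admissible u ps cs p) [0..<min (Suc m) (k - 1)])"
      using True c(1) by auto
    with Suc.prems(1) obtain t' where "verify u w k n t' (ps @ [p]) (cs @ [c]) (max m (Suc c))"
      unfolding t verify.simps by (elim conjE list_all2_memberE)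
    moreover have "set (cs @ [c]) = {..<max m (Suc c)}"
      unfolding set_append list.set Suc.prems(3) using c(1) by force
    moreover have "length (cs @ [c]) = length (ps @ [p])"
      using Suc.prems(2) by simp
    ultimately show ?thesis
      using Suc.IH by blast
  next
    case False
    \<comment> \<open>Here \<open>k - 1 \<le> c \<le> m\<close>, so an element of
      \<open>{..<k}\<close> that is not below \<open>m\<close> equals \<open>c\<close>.\<close>
    have "insert c {..<m} \<supseteq> {..<k}"
      using False c(1) by auto
    then have "k \<le> card (set (cs @ [c]))"
      using card_mono[of "insert c {..<m}" "{..<k}"] Suc.prems(3) by simp
    then show ?thesis by (cases n) auto
  qed
  have "winning w k n (scale u (ps @ [p])) (cs @ [c])"
    if c: "chain_partition (scale u (ps @ [p])) (cs @ [c])" for c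
  proof (cases "c \<le> m")
    case False
    \<comment> \<open>Neither \<open>m\<close> nor \<open>c\<close> is in use, so this renaming
      fixes the old labels and stays injective.\<close>
    define f where "f = id(m := c)"
    have inj: "inj_on f (set (cs @ [m]))"
      using False Suc.prems(3) by (auto simp: f_def inj_on_def)
    have "map f cs = map id cs"
      using Suc.prems(3) by (intro map_cong) (auto simp: f_def)
    then have map: "map f (cs @ [m]) = cs @ [c]"
      by (simp add: f_def)
    then have "chain_partition (scale u (ps @ [p])) (cs @ [m])"
      using c chain_partition_map[OF inj] by metis
    then show ?thesis
      using winning_map[OF low inj] map by simp
  qed (use c low in blast)
  moreover have "interval_width (scale u (ps @ [p])) \<le> w"
    using Suc.prems(1) interval_width_scale assms(1) unfolding t by simp
  ultimately show ?case
    unfolding winning.simps by (metis snoc)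
qed simp

text \<open>End points are in ninths. For instance, 6 is more than 9 away from 20, so its label may
  be the old one (answered by \<open>Move 0\<close>) or a new one (answered by
  \<open>Move 3\<close>). A node without subtrees meets intervals of all four labels and so forces a
  fifth.\<close>

definition five_chains :: strategy where
  "five_chains =
    Move 20 [
      Move 6 [
        Move 0 [
          Move 17 [Move 7 [Move 10 [Move 16 []]], Move 18 [Move 8 [Move 10 []], Move 9 []]]],
        Move 3 [
          Move 23 [Move 7 [Move 13 [Move 16 []]], Move 5 [Move 13 [Move 15 []], Move 14 []]],
          Move 23 [
            Move 21 [Move 11 [Move 13 []], Move 12 []],
            Move 11 [Move 14 []],
            Move 13 [Move 14 [], Move 11 []]]]]]"

text \<open>The round bound 7 is the number of moves on a longest branch.\<close>

lemma verify_five_chains: "verify 9 3 5 7 five_chains [] [] 0"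
  by code_simp

theorem corollary3p1: "olws_R 3 = 5"
  unfolding olws_R_def
proof (rule Greatest_equality)
  have "winning 3 5 7 (scale 9 []) []"
    by (rule winning_if_verify[OF _ verify_five_chains]) auto
  then show "forces_chains 3 5"
    by (intro forces_chainsI) (simp add: scale_def)
  \<comment> \<open>First Fit gives the bound \<open>2 * 3 - 1\<close>.\<close>
  show "k \<le> 5" if "forces_chains 3 k" for k
    using forces_chains_le[OF that] by simp
qed

end
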